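(* Let $n,k\ge 1$ and let ${\bf C}=(C_0,C_1,\dots,C_k)$ be a $(k+1)$-tuple of real $n\times n$ matrices. Suppose that (i) ${\bf C}$ has the $R_0$-$W$ property, and (ii) the EHLCP-degree of ${\bf C}$ is non-zero, $\deg({\bf C},{\bf 0})\neq 0$, i.e. $\deg(F_{{\bf C},\hat{\bf d}},\Omega,{\bf 0})\ne 0$, where $\hat{\bf d}\in(\mathbb{R}^n_{++})^{k-1}$ is the tuple used to define the degree and $\Omega\subset(\mathbb{R}^n)^{k+1}$ is a bounded open set containing the origin. Then for all $q\in\mathbb{R}^n$ and all ${\bf d}\in(\mathbb{R}^n_{++})^{k-1}$, the solution set $\mathrm{SOL}({\bf C},{\bf d},q)$ of $\mathrm{EHLCP}({\bf C},{\bf d},q)$ is non-empty and compact.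
   Context: Notation: $[k]=\{1,\dots,k\}$; $\mathbb{R}^n_{++}$ is the set of vectors in $\mathbb{R}^n$ with all entries positive; $x\wedge y$ is the componentwise minimum of $x,y\in\mathbb{R}^n$. Extended horizontal linear complementarity problem: given ${\bf C}=(C_0,\dots,C_k)$ with $C_i\in\mathbb{R}^{n\times n}$, $q\in\mathbb{R}^n$ and ${\bf d}=(d_1,\dots,d_{k-1})\in(\mathbb{R}^n_{++})^{k-1}$ (empty if $k=1$), $\mathrm{EHLCP}({\bf C},{\bf d},q)$ asks for $(x_0,x_1,\dots,x_k)\in(\mathbb{R}^n)^{k+1}$ with $$C_0x_0=q+\sum_{i=1}^k C_ix_i,\qquad x_0\wedge x_1=0,\qquad (d_j-x_j)\wedge x_{j+1}=0\ \ (1\le j\le k-1).$$ $\mathrm{SOL}({\bf C},{\bf d},q)$ denotes the set of all its solutions. ${\bf C}$ has the $R_0$-$W$ property if the only $(x_0,\dots,x_k)\in(\mathbb{R}^n)^{k+1}$ satisfying $C_0x_0=\sum_{i=1}^kC_ix_i$ and $x_0\wedge x_j=0$ for all $j\in[k]$ is the zero vector. EHLCP-degree: for ${\bf d}\in(\mathbb{R}^n_{++})^{k-1}$ define $F_{{\bf C},{\bf d}}:(\mathbb{R}^n)^{k+1}\to(\mathbb{R}^n)^{k+1}$ by $$F_{{\bf C},{\bf d}}(x_0,\dots,x_k)=\Big(C_0x_0-\sum_{i=1}^kC_ix_i,\ x_0\wedge x_1,\ (d_1-x_1)\wedge x_2,\ \dots,\ (d_{k-1}-x_{k-1})\wedge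 x_k\Big).$$ For a continuous $h:\overline{\Omega}\to\mathbb{R}^N$ with $\Omega\subset\mathbb{R}^N$ open and bounded and $p\notin h(\partial\Omega)$, $\deg(h,\Omega,p)$ is the Brouwer degree. If ${\bf C}$ has the $R_0$-$W$ property, then $F_{{\bf C},{\bf d}}$ vanishes only at the origin, so $\deg(F_{{\bf C},{\bf d}},\Omega,{\bf 0})$ is the same for all bounded open $\Omega\subset(\mathbb{R}^n)^{k+1}$ containing the origin; this common value is called the EHLCP-degree of ${\bf C}$ and denoted $\deg({\bf C},{\bf 0})$. *)

theory Defs
  imports "HOL-Analysis.Analysis" "HOL-Homology.Homology"
begin

section \<open>Brouwer degree\<close>

text \<open>
  The Brouwer degree of \<open>h\<close> on the bounded open set \<open>\<Omega>\<close> over \<open>p\<close>, in its homological form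
  (Dold, Lectures on Algebraic Topology, Chapter IV.5).  Let \<open>N\<close> be the dimension of the space,
  \<open>K = {x \<in> \<Omega>. h x = p}\<close>, which is compact if \<open>h\<close> is continuous on \<open>closure \<Omega>\<close> and
  \<open>p \<notin> h ` frontier \<Omega>\<close>, and let \<open>cball 0 R\<close> contain \<open>\<Omega>\<close> and \<open>p\<close>.  Writing \<open>E\<close> for the whole space
  and \<open>H(X,A)\<close> for relative homology in dimension \<open>N\<close>, there are homomorphisms

  \<open>H(E, E - cball 0 R) \<rightarrow> H(E, E - K) \<leftarrow> H(\<Omega>, \<Omega> - K) \<rightarrow> H(E, E - {p})\<close>

  of which the first two are induced by inclusions, the second being an excision isomorphism, and
  the third by \<open>h\<close>.  Their composite sends the orientation class \<open>z\<close>, a generator of the infinite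
  cyclic group \<open>H(E, E - cball 0 R)\<close>, to \<open>deg h\<close> times the orientation class at \<open>p\<close>, which is the
  image of the same \<open>z\<close> under the inclusion-induced isomorphism to \<open>H(E, E - {p})\<close>.  By linearity
  one may quantify over all \<open>z\<close> instead of choosing a generator.  The value is meaningful only
  for bounded open \<open>\<Omega>\<close>, \<open>h\<close> continuous on \<open>closure \<Omega>\<close> and \<open>p \<notin> h ` frontier \<Omega>\<close>.
\<close>

definition is_brouwer_degree ::
    "('a::euclidean_space \<Rightarrow> 'a) \<Rightarrow> 'a set \<Rightarrow> 'a \<Rightarrow> int \<Rightarrow> bool" where
  "is_brouwer_degree h \<Omega> p d \<longleftrightarrow>
    (let N = int DIM('a); K = {x \<in> \<Omega>. h x = p} in
      \<forall>R. insert p \<Omega> \<subseteq> cball 0 R \<longrightarrow>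
        (\<forall>z \<in> carrier (relative_homology_group N euclidean (- cball 0 R)).
         \<forall>w \<in> carrier (relative_homology_group N (top_of_set \<Omega>) (\<Omega> - K)).
           hom_induced N (top_of_set \<Omega>) (\<Omega> - K) euclidean (- K) id w
             = hom_induced N euclidean (- cball 0 R) euclidean (- K) id z
           \<longrightarrow> hom_induced N (top_of_set \<Omega>) (\<Omega> - K) euclidean (- {p}) h w
             = hom_induced N euclidean (- cball 0 R) euclidean (- {p}) id z
                 [^]\<^bsub>relative_homology_group N euclidean (- {p})\<^esub> d))"

definition brouwer_degree :: "('a::euclidean_space \<Rightarrow> 'a) \<Rightarrow> 'a set \<Rightarrow> 'a \<Rightarrow> int" where
  "brouwer_degree h \<Omega> p = (THE d. is_brouwer_degree h \<Omega> p d)"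


section \<open>Block vectors\<close>

text \<open>
  A tuple \<open>(x\<^sub>0, \<dots>, x\<^sub>k)\<close> of vectors in \<open>real ^ 'n\<close> is an element of \<open>real ^ 'n ^ 'm::enum\<close> with
  \<open>CARD('m) = k + 1\<close>; the enumeration of the index type provides the numbering by \<open>0, \<dots>, k\<close>.
\<close>

definition blk :: "'a ^ 'm::enum \<Rightarrow> nat \<Rightarrow> 'a" where
  "blk x j = x $ (Enum.enum ! j)"

definition of_blks :: "(nat \<Rightarrow> 'a) \<Rightarrow> 'a ^ 'm::enum" where
  "of_blks g = (\<chi> i. g (THE j. j < CARD('m) \<and> Enum.enum ! j = i))"

lemma blk_of_blks:
  assumes "j < CARD('m::enum)"
  shows "blk (of_blks g :: 'a ^ 'm::enum) j = g j"
proof -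
  have "(THE l. l < CARD('m) \<and> Enum.enum ! l = (Enum.enum ! j :: 'm)) = j"
    using assms by (intro the_equality)
      (auto simp: card_UNIV_length_enum nth_eq_iff_index_eq enum_distinct)
  then show ?thesis
    by (simp add: blk_def of_blks_def)
qed

lemma blk_eqI:
  assumes "\<And>j. j < CARD('m::enum) \<Longrightarrow> blk x j = blk y j"
  shows "x = (y :: 'a ^ 'm::enum)"
proof -
  have "x $ i = y $ i" for i
  proof -
    have "i \<in> set (Enum.enum :: 'm list)"
      by (simp add: enum_UNIV)
    then obtain j where "j < CARD('m)" "Enum.enum ! j = i"
      by (auto simp: in_set_conv_nth card_UNIV_length_enum)
    then show ?thesis
      using assms[of j] by (simp add: blk_def)
  qed
  then show ?thesis
    by (simp add: vec_eq_iff)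
qed


section \<open>The extended horizontal linear complementarity problem\<close>

text \<open>
  Of \<open>C\<close> only \<open>C 0, \<dots>, C k\<close> matter, of \<open>d\<close> only \<open>d 1, \<dots>, d (k - 1)\<close>.  On \<open>real ^ 'n\<close>, \<open>inf\<close> is the
  componentwise minimum.
\<close>

definition pos_tuple :: "nat \<Rightarrow> (nat \<Rightarrow> real ^ 'n) \<Rightarrow> bool" where
  "pos_tuple k d \<longleftrightarrow> (\<forall>j \<in> {1..k - 1}. \<forall>i. 0 < d j $ i)"

definition EHLCP_SOL ::
    "nat \<Rightarrow> (nat \<Rightarrow> real ^ 'n ^ 'n) \<Rightarrow> (nat \<Rightarrow> real ^ 'n) \<Rightarrow> real ^ 'n \<Rightarrow> (real ^ 'n ^ 'm::enum) set" where
  "EHLCP_SOL k C d q = {x.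
     C 0 *v blk x 0 = q + (\<Sum>i = 1..k. C i *v blk x i) \<and>
     inf (blk x 0) (blk x 1) = 0 \<and>
     (\<forall>j \<in> {1..k - 1}. inf (d j - blk x j) (blk x (j + 1)) = 0)}"

definition R0_W :: "'m::enum itself \<Rightarrow> nat \<Rightarrow> (nat \<Rightarrow> real ^ 'n ^ 'n) \<Rightarrow> bool" where
  "R0_W _ k C \<longleftrightarrow> (\<forall>x :: real ^ 'n ^ 'm::enum.
     C 0 *v blk x 0 = (\<Sum>i = 1..k. C i *v blk x i) \<and>
     (\<forall>j \<in> {1..k}. inf (blk x 0) (blk x j) = 0) \<longrightarrow> x = 0)"

definition EHLCP_map ::
    "nat \<Rightarrow> (nat \<Rightarrow> real ^ 'n ^ 'n) \<Rightarrow> (nat \<Rightarrow> real ^ 'n) \<Rightarrow> real ^ 'n ^ 'm::enum \<Rightarrow> real ^ 'n ^ 'm::enum" where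
  "EHLCP_map k C d x = of_blks (\<lambda>j.
     if j = 0 then C 0 *v blk x 0 - (\<Sum>i = 1..k. C i *v blk x i)
     else if j = 1 then inf (blk x 0) (blk x 1)
     else inf (d (j - 1) - blk x (j - 1)) (blk x j))"

end

theory Submission
  imports Defs
begin

text \<open>
  In a solution, \<open>x\<^sub>0 > 0\<close> in a coordinate forces \<open>x\<^sub>1 = 0\<close>, hence \<open>d\<^sub>1 - x\<^sub>1 > 0\<close>, hence \<open>x\<^sub>2 = 0\<close>, and
  so on: every \<open>x\<^sub>j\<close> is complementary to \<open>x\<^sub>0\<close>.  By the \<open>R\<^sub>0\<close>-\<open>W\<close> property and compactness of the unit
  sphere, \<open>norm (C\<^sub>0 x\<^sub>0 - \<Sum> C\<^sub>i x\<^sub>i) + \<Sum> norm (x\<^sub>0 \<and> x\<^sub>j) \<ge> c * norm x\<close> for some \<open>c > 0\<close>, so solutions satisfy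
  \<open>norm x \<le> norm q / c\<close> whatever \<open>d\<close> is.  Hence the straight-line homotopy from \<open>(d_hat, 0)\<close> to \<open>(d, q)\<close>
  has no zeros outside a fixed ball.  If \<open>(d, q)\<close> had no solution, the map defining the degree would be
  homotopic, as a map of pairs \<open>(E, E - ball) \<rightarrow> (E, E - {0})\<close>, to a map missing \<open>0\<close>; it would thus vanish
  in homology, and the degree would be \<open>0\<close>.
\<close>

section \<open>Brouwer degree\<close>

lemma topspace_Int_minus_zero_nonempty:
  "topspace euclidean \<inter> (- {0::'a::euclidean_space}) \<noteq> {}"
proof -
  obtain b where "(b::'a) \<in> Basis" using nonempty_Basis by blast
  then show ?thesis using nonzero_Basis by auto
qed

text \<open>The whole space is contractible, so the boundary map leads to reduced homology of the
  punctured space one dimension lower. That space is homotopy equivalent to the unit sphere, whose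
  top reduced group is infinite cyclic.\<close>

lemma isomorphic_relative_homology_punctured_euclidean:
  "relative_homology_group (int DIM('a)) euclidean (- {0::'a::euclidean_space}) \<cong> integer_group"
proof -
  have "(sphere (0::'a) 1) homotopy_eqv (- {0::'a})"
  proof -
    have "rel_frontier (cball (0::'a) 1) homotopy_eqv (affine hull (cball (0::'a) 1) - {0})"
      by (rule homotopy_eqv_rel_frontier_punctured_affine_hull)
         (simp_all add: rel_interior_interior affine_hull_nonempty_interior)
    then show ?thesis
      by (simp add: rel_frontier_def rel_interior_interior affine_hull_nonempty_interior
          cball_diff_eq_sphere Compl_eq_Diff_UNIV)
  qed
  \<comment> \<open>\<open>nsphere\<close> consists of real sequences; the orthonormal set
    \<open>Basis\<close> carries it to the unit sphere of \<open>'a\<close>.\<close>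
  moreover obtain f :: "(nat \<Rightarrow> real) \<Rightarrow> 'a" and g
    where "homeomorphic_maps (nsphere (DIM('a) - 1)) (top_of_set (sphere 0 1 \<inter> span Basis)) f g"
    using homeomorphic_maps_nsphere_euclidean_sphere
            [of Basis "DIM('a)", OF independent_Basis orthogonal_Basis refl _ norm_Basis] by auto
  ultimately have "nsphere (DIM('a) - 1) homotopy_equivalent_space top_of_set (- {0::'a})"
    by (metis homeomorphic_imp_homotopy_equivalent_space homeomorphic_space_def homotopy_eqv_trans
        inf_top.right_neutral span_Basis)
  then have "reduced_homology_group (int DIM('a) - 1) (nsphere (DIM('a) - 1)) \<cong>
      reduced_homology_group (int DIM('a) - 1) (top_of_set (- {0::'a}))"
    by (rule homotopy_equivalent_space_imp_isomorphic_reduced_homology_groups)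
  moreover have "reduced_homology_group (int DIM('a) - 1) (nsphere (DIM('a) - 1)) \<cong> integer_group"
    using reduced_homology_group_nsphere(1)[of "DIM('a) - 1"] DIM_positive[where 'a='a]
    by (simp add: of_nat_diff Suc_leI)
  ultimately have "reduced_homology_group (int DIM('a) - 1) (top_of_set (- {0::'a})) \<cong> integer_group"
    using group.iso_sym group_reduced_homology_group iso_trans by blast
  moreover have "relative_homology_group (int DIM('a)) euclidean (- {0::'a}) \<cong>
      reduced_homology_group (int DIM('a) - 1) (top_of_set (- {0::'a}))"
    by (rule isomorphic_group_relative_homology_of_contractible)
       (use topspace_Int_minus_zero_nonempty[where 'a='a] contractible_space_top_of_set[of "UNIV::'a set"] in auto)
  ultimately show ?thesis
    using iso_trans by blast
qed

text \<open>Pushing points radially outward by \<open>R\<close> is a homotopy inverse of the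
  inclusion of the complement of the ball into the punctured space. Naturality of the boundary map
  lifts this to relative homology.\<close>

lemma iso_hom_induced_complement_cball:
  assumes "R \<ge> 0"
  shows "hom_induced p euclidean (- cball (0::'a::euclidean_space) R) euclidean (- {0}) id
    \<in> iso (relative_homology_group p euclidean (- cball 0 R)) (relative_homology_group p euclidean (- {0}))"
proof -
  define r where "r = (\<lambda>x::'a. x + (R / norm x) *\<^sub>R x)"
  let ?A = "- cball (0::'a) R" and ?B = "- {0::'a}"
  have sub: "?A \<subseteq> ?B"
    using assms by auto
  have contr: "continuous_on ?B r"
    unfolding r_def by (intro continuous_intros) auto
  have norm_ray: "norm (x + a *\<^sub>R x) = (1 + a) * norm x" if "a \<ge> 0" for x :: 'a and a
    using that by (metis abs_of_nonneg add_nonneg_nonneg norm_scaleR scaleR_left_distrib scaleR_one zero_le_one)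
  have normr: "norm (r x) = norm x + R" if "x \<noteq> 0" for x
    using that assms unfolding r_def by (subst norm_ray) (auto simp: field_simps)
  have rim: "r ` ?B \<subseteq> ?A"
    using normr assms by auto
  \<comment> \<open>One estimate serves both homotopies: the segment from \<open>r x\<close> to
    \<open>x\<close> stays outside the ball if \<open>x\<close> does, and away from the origin if
    \<open>x\<close> does.\<close>
  have segment: "norm y \<ge> norm x" if y: "y \<in> closed_segment (r x) x" for x y
  proof -
    obtain u where u: "0 \<le> u" "u \<le> 1" "y = (1 - u) *\<^sub>R r x + u *\<^sub>R x"
      using y by (auto simp: closed_segment_def)
    have "y = x + ((1 - u) * (R / norm x)) *\<^sub>R x"
      using u by (simp add: r_def algebra_simps)
    then show ?thesis
      using u assms by (simp add: norm_ray mult_le_cancel_right1 add_increasing2 distrib_right)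
  qed
  have "homotopic_with (\<lambda>h. True) (top_of_set ?A) (top_of_set ?A) (r \<circ> id) id"
  proof -
    have "homotopic_with_canon (\<lambda>h. True) ?A ?A r (\<lambda>x. x)"
      using contr sub
      by (intro homotopic_with_linear) (auto intro: continuous_on_subset dest!: segment)
    then show ?thesis by (simp add: id_def comp_def)
  qed
  moreover have "homotopic_with (\<lambda>h. True) (top_of_set ?B) (top_of_set ?B) (id \<circ> r) id"
  proof -
    have "homotopic_with_canon (\<lambda>h. True) ?B ?B r (\<lambda>x. x)"
      using contr
      by (intro homotopic_with_linear) (auto dest!: segment)
    then show ?thesis by (simp add: id_def comp_def)
  qed
  ultimately have iso: "hom_induced (p - 1) (top_of_set ?A) {} (top_of_set ?B) {} id
      \<in> iso (reduced_homology_group (p - 1) (top_of_set ?A)) (reduced_homology_group (p - 1) (top_of_set ?B))"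
    using sub rim contr
    by (intro homotopy_equivalence_reduced_homology_group_isomorphism[where g = r])
       (auto simp: id_def)
  have contractible: "contractible_space (euclidean :: 'a topology)"
    using contractible_space_top_of_set[of "UNIV::'a set"] by simp
  \<comment> \<open>Passing to reduced homology requires a nonempty subspace; the ball is bounded,
    so its complement has a point.\<close>
  have "\<not> - ?A = UNIV"
    using not_bounded_UNIV bounded_cball by (metis double_complement)
  then have isoA: "hom_boundary p euclidean ?A
      \<in> iso (relative_homology_group p euclidean ?A) (reduced_homology_group (p - 1) (top_of_set ?A))"
    by (intro iso_relative_homology_of_contractible contractible) auto
  have isoB: "hom_boundary p euclidean ?B
      \<in> iso (relative_homology_group p euclidean ?B) (reduced_homology_group (p - 1) (top_of_set ?B))"
    by (intro iso_relative_homology_of_contractible contractible topspace_Int_minus_zero_nonempty)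
  have nat: "hom_boundary p euclidean ?B \<circ> hom_induced p euclidean ?A euclidean ?B id
     = hom_induced (p - 1) (top_of_set ?A) {} (top_of_set ?B) {} id \<circ> hom_boundary p euclidean ?A"
    using sub by (intro naturality_hom_induced) auto
  show ?thesis
  proof (rule isoI)
    show "hom_induced p euclidean ?A euclidean ?B id
      \<in> hom (relative_homology_group p euclidean ?A) (relative_homology_group p euclidean ?B)"
      by (rule hom_induced_hom)
    \<comment> \<open>Three sides of the naturality square are bijective, hence so is the
      fourth.\<close>
    have "bij_betw (hom_boundary p euclidean ?B \<circ> hom_induced p euclidean ?A euclidean ?B id)
       (carrier (relative_homology_group p euclidean ?A)) (carrier (reduced_homology_group (p - 1) (top_of_set ?B)))"
      unfolding nat using iso isoA by (auto simp: iso_def intro: bij_betw_trans)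
    then show "bij_betw (hom_induced p euclidean ?A euclidean ?B id)
       (carrier (relative_homology_group p euclidean ?A)) (carrier (relative_homology_group p euclidean ?B))"
      using isoB hom_induced_carrier
      by (subst bij_betw_comp_iff2[where A' = "carrier (relative_homology_group p euclidean ?B)"])
        (auto simp: iso_def)
  qed
qed

text \<open>Excise the complement of \<open>\<Omega>\<close>: it is closed, and it lies in the open
  set \<open>- {a}\<close> because \<open>a\<close> is in \<open>\<Omega>\<close>.\<close>

lemma iso_hom_induced_excision_open:
  assumes "open \<Omega>" "(a::'a::euclidean_space) \<in> \<Omega>"
  shows "hom_induced p (top_of_set \<Omega>) (\<Omega> - {a}) euclidean (- {a}) id
    \<in> iso (relative_homology_group p (top_of_set \<Omega>) (\<Omega> - {a})) (relative_homology_group p euclidean (- {a}))"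
proof -
  have eqs: "- {a} - - \<Omega> = \<Omega> - {a}" "UNIV - - \<Omega> = \<Omega>"
    by auto
  have "euclidean closure_of (- \<Omega>) \<subseteq> euclidean interior_of (- {a})"
    using assms by (simp add: interior_open open_Compl closure_closed closed_Compl)
  then show ?thesis
    using homology_excision_axiom[of euclidean "- \<Omega>" "- {a}" UNIV p] by (simp only: eqs subtopology_UNIV subset_UNIV)
qed

text \<open>Such an element detects exponents, which makes the degree unique. The preimage of 1
  under the isomorphism works.\<close>

lemma int_pow_free_element:
  assumes "group G" "G \<cong> integer_group"
  obtains y where "y \<in> carrier G" "\<And>d::int. y [^]\<^bsub>G\<^esub> d = \<one>\<^bsub>G\<^esub> \<Longrightarrow> d = 0"
proof -
  obtain \<phi> where \<phi>: "\<phi> \<in> iso G integer_group"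
    using assms(2) by (auto simp: is_iso_def)
  then have im: "\<phi> ` carrier G = UNIV"
    by (auto simp: iso_def bij_betw_def)
  then obtain y where y: "y \<in> carrier G" "\<phi> y = 1"
    by (metis UNIV_I image_iff)
  interpret group_hom G integer_group \<phi>
    using \<phi> assms(1) by (simp add: group_hom_def group_hom_axioms_def iso_imp_homomorphism)
  show ?thesis
  proof
    fix d :: int
    assume "y [^]\<^bsub>G\<^esub> d = \<one>\<^bsub>G\<^esub>"
    then have "\<phi> y [^]\<^bsub>integer_group\<^esub> d = 0"
      using y(1) hom_int_pow hom_one by (metis one_integer_group)
    then show "d = 0"
      by (simp add: y(2))
  qed (rule y(1))
qed

section \<open>Degree zero for maps deformable to one without zeros\<close>

text \<open>The map of pairs factors through \<open>(X, X)\<close>, whose relative homology is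
  trivial.\<close>

lemma hom_induced_avoiding:
  assumes "continuous_map X Y f" "f \<in> topspace X \<rightarrow> T"
  shows "hom_induced p X S Y T f c = \<one>\<^bsub>relative_homology_group p Y T\<^esub>"
proof (cases "c \<in> carrier (relative_homology_group p X S)")
  case True
  let ?c = "hom_induced p X (topspace X \<inter> S) X (topspace X) id c"
  have "hom_induced p X (topspace X) Y T f ?c = hom_induced p X (topspace X \<inter> S) Y T (f \<circ> id) c"
    using assms by (intro hom_induced_compose') auto
  then have "hom_induced p X S Y T f c = hom_induced p X (topspace X) Y T f ?c"
    by (metis comp_id hom_induced_restrict inf.left_idem)
  also have "?c = \<one>\<^bsub>relative_homology_group p X (topspace X)\<^esub>"
    using hom_induced_carrier trivial_relative_homology_group_topspace
    by (metis singletonD trivial_group_def)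
  finally show ?thesis
    by (metis group_relative_homology_group hom_induced_hom hom_one)
next
  \<comment> \<open>Outside the carrier, \<open>hom_induced\<close> returns the identity by
    convention.\<close>
  case False
  then show ?thesis
    by (simp add: hom_induced_default)
qed

text \<open>The homotopy may have zeros inside the ball, so it is not one of maps on the pair with
  \<open>- {0}\<close>. It is one on the pair with \<open>- cball 0 R\<close>, and every class comes
  from there.\<close>

lemma hom_induced_trivial_of_homotopy:
  fixes h :: "'a::euclidean_space \<Rightarrow> 'a" and G :: "real \<Rightarrow> 'a \<Rightarrow> 'a"
  assumes h: "continuous_on UNIV h" "\<And>x. h x = 0 \<longleftrightarrow> x = 0"
    and G: "continuous_on ({0..1} \<times> UNIV) (\<lambda>(t, x). G t x)" "\<And>x. G 0 x = h x" "\<And>x. G 1 x \<noteq> 0"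
    and R: "R \<ge> 0" "\<And>t x. \<lbrakk>t \<in> {0..1}; G t x = 0\<rbrakk> \<Longrightarrow> norm x \<le> R"
    and v: "v \<in> carrier (relative_homology_group p euclidean (- {0::'a}))"
  shows "hom_induced p euclidean (- {0}) euclidean (- {0}) h v
    = \<one>\<^bsub>relative_homology_group p euclidean (- {0::'a})\<^esub>"
proof -
  have "v \<in> hom_induced p euclidean (- cball 0 R) euclidean (- {0}) id
      ` carrier (relative_homology_group p euclidean (- cball 0 R))"
    using iso_hom_induced_complement_cball[OF R(1), of p, where 'a='a] v
    by (simp add: iso_def bij_betw_def)
  then obtain u where u: "v = hom_induced p euclidean (- cball 0 R) euclidean (- {0}) id u"
    by blast
  have "homotopic_with (\<lambda>f. f \<in> - cball 0 R \<rightarrow> - {0}) euclidean euclidean h (G 1)"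
  proof -
    have "continuous_map (prod_topology (top_of_set {0..1}) euclidean) euclidean (\<lambda>(t, x). G t x)"
      using G(1) by (metis continuous_map_iff_continuous prod_topology_subtopology_eu subtopology_UNIV)
    moreover have "(\<lambda>x. G t x) \<in> - cball 0 R \<rightarrow> - {0}" if "t \<in> {0..1}" for t
      using R(2)[OF that] by auto
    ultimately show ?thesis
      using G(2) unfolding homotopic_with_def by (intro exI[of _ "\<lambda>(t, x). G t x"]) auto
  qed
  then have "hom_induced p euclidean (- cball 0 R) euclidean (- {0}) h
      = hom_induced p euclidean (- cball 0 R) euclidean (- {0}) (G 1)"
    by (rule homology_homotopy_axiom)
  moreover have "continuous_on UNIV (G 1)"
    using continuous_on_compose2[OF G(1), of UNIV "\<lambda>x. (1, x)"] by (simp add: continuous_on_Pair image_subset_iff)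
  then have "hom_induced p euclidean (- cball 0 R) euclidean (- {0}) (G 1) u
      = \<one>\<^bsub>relative_homology_group p euclidean (- {0::'a})\<^esub>"
    using G(3) by (intro hom_induced_avoiding) auto
  \<comment> \<open>At time 0 there is no zero but the origin, so \<open>h\<close> acts on both
    pairs, compatibly with the inclusion.\<close>
  moreover have "hom_induced p euclidean (- {0}) euclidean (- {0}) h v
      = hom_induced p euclidean (- cball 0 R) euclidean (- {0}) h u"
  proof -
    have "h \<in> - {0} \<rightarrow> - {0}"
      by (simp add: Pi_iff h(2))
    moreover have "(id :: 'a \<Rightarrow> 'a) \<in> - cball 0 R \<rightarrow> - {0}"
      using R(1) by (auto simp: Pi_iff)
    moreover have "continuous_map euclidean euclidean h"
      using h(1) by simp
    ultimately have "hom_induced p euclidean (- {0}) euclidean (- {0}) h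
        (hom_induced p euclidean (- cball 0 R) euclidean (- {0}) id u)
      = hom_induced p euclidean (- cball 0 R) euclidean (- {0}) (h \<circ> id) u"
      by (metis hom_induced_compose' continuous_map_id)
    then show ?thesis
      by (simp only: u comp_id)
  qed
  ultimately show ?thesis
    by simp
qed

text \<open>As the degree is a definite description, 0 must be shown both to satisfy the
  specification and to be the only integer that does.\<close>

proposition brouwer_degree_eq_0_of_homotopy:
  fixes h :: "'a::euclidean_space \<Rightarrow> 'a" and G :: "real \<Rightarrow> 'a \<Rightarrow> 'a"
  assumes \<Omega>: "open \<Omega>" "bounded \<Omega>" "0 \<in> \<Omega>"
    and h: "continuous_on UNIV h" "\<And>x. h x = 0 \<longleftrightarrow> x = 0"
    and G: "continuous_on ({0..1} \<times> UNIV) (\<lambda>(t, x). G t x)" "\<And>x. G 0 x = h x" "\<And>x. G 1 x \<noteq> 0"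
    and R: "R \<ge> 0" "\<And>t x. \<lbrakk>t \<in> {0..1}; G t x = 0\<rbrakk> \<Longrightarrow> norm x \<le> R"
  shows "brouwer_degree h \<Omega> 0 = 0"
proof -
  define N where "N = int DIM('a)"
  let ?H = "relative_homology_group N euclidean (- {0::'a})"
  let ?K = "relative_homology_group N (top_of_set \<Omega>) (\<Omega> - {0})"
  have K: "{x \<in> \<Omega>. h x = 0} = {0}"
    using \<Omega> h by auto
  have h_trivial: "hom_induced N (top_of_set \<Omega>) (\<Omega> - {0}) euclidean (- {0}) h w = \<one>\<^bsub>?H\<^esub>"
    if "w \<in> carrier ?K" for w
  proof -
    have "hom_induced N (top_of_set \<Omega>) (\<Omega> - {0}) euclidean (- {0}) h w
      = hom_induced N euclidean (- {0}) euclidean (- {0}) h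
          (hom_induced N (top_of_set \<Omega>) (\<Omega> - {0}) euclidean (- {0}) id w)"
      using h by (subst hom_induced_compose') auto
    also have "\<dots> = \<one>\<^bsub>?H\<^esub>"
      using h G R hom_induced_carrier by (rule hom_induced_trivial_of_homotopy)
    finally show ?thesis .
  qed
  have "is_brouwer_degree h \<Omega> 0 0"
    unfolding is_brouwer_degree_def Let_def K N_def[symmetric] using h_trivial by simp
  \<comment> \<open>Lift one element \<open>y\<close> of infinite order both to \<open>z\<close> and
    to \<open>w\<close>. The specification then equates the image of \<open>w\<close> under
    \<open>h\<close>, which is trivial, with the power \<open>d\<close> of \<open>y\<close>.\<close>
  moreover have "d = 0" if d: "is_brouwer_degree h \<Omega> 0 d" for d
  proof -
    obtain y where y: "y \<in> carrier ?H" "\<And>d::int. y [^]\<^bsub>?H\<^esub> d = \<one>\<^bsub>?H\<^esub> \<Longrightarrow> d = 0"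
      using int_pow_free_element isomorphic_relative_homology_punctured_euclidean[where 'a='a]
      unfolding N_def by (metis group_relative_homology_group)
    obtain S where S: "\<Omega> \<subseteq> cball 0 S"
      using \<Omega>(2) by (auto simp: bounded_iff subset_iff)
    then have "S \<ge> 0"
      using \<Omega>(3) by auto
    then have "y \<in> hom_induced N euclidean (- cball 0 S) euclidean (- {0}) id
        ` carrier (relative_homology_group N euclidean (- cball 0 S))"
      using iso_hom_induced_complement_cball[of S N, where 'a='a] y(1) by (simp add: iso_def bij_betw_def)
    then obtain z where z: "z \<in> carrier (relative_homology_group N euclidean (- cball 0 S))"
        "hom_induced N euclidean (- cball 0 S) euclidean (- {0}) id z = y"
      by blast
    have "y \<in> hom_induced N (top_of_set \<Omega>) (\<Omega> - {0}) euclidean (- {0}) id ` carrier ?K"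
      using iso_hom_induced_excision_open[OF \<Omega>(1,3), of N] y(1) by (simp add: iso_def bij_betw_def)
    then obtain w where w: "w \<in> carrier ?K"
        "hom_induced N (top_of_set \<Omega>) (\<Omega> - {0}) euclidean (- {0}) id w = y"
      by blast
    have "insert 0 \<Omega> \<subseteq> cball 0 S"
      using S \<Omega>(3) by auto
    then have "hom_induced N (top_of_set \<Omega>) (\<Omega> - {0}) euclidean (- {0}) h w = y [^]\<^bsub>?H\<^esub> d"
      using d z w unfolding is_brouwer_degree_def Let_def K N_def[symmetric] by metis
    then show ?thesis
      using h_trivial[OF w(1)] y(2) by simp
  qed
  ultimately show ?thesis
    unfolding brouwer_degree_def by (rule the_equality)
qed

section \<open>Solutions of the complementarity problem\<close>

lemma continuous_on_inf_euclidean [continuous_intros]: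
  fixes f g :: "'a::topological_space \<Rightarrow> 'b::ordered_euclidean_space"
  assumes "continuous_on S f" "continuous_on S g"
  shows "continuous_on S (\<lambda>x. inf (f x) (g x))"
  using assms by (auto simp: continuous_on_def intro!: tendsto_inf)

lemma continuous_on_blk [continuous_intros]:
  fixes f :: "'a::topological_space \<Rightarrow> ('b::topological_space) ^ 'm::enum"
  assumes "continuous_on S f"
  shows "continuous_on S (\<lambda>x. blk (f x) j)"
  unfolding blk_def using assms by (intro continuous_intros)

lemma continuous_on_matrix_vector_mult [continuous_intros]:
  fixes A :: "real ^ 'n ^ 'm"
  assumes "continuous_on S f"
  shows "continuous_on S (\<lambda>x. A *v f x)"
  using continuous_on_compose2[OF matrix_vector_mult_linear_continuous_on assms] by blast

lemma of_blks_nth_enum: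
  assumes "j < CARD('m::enum)"
  shows "(of_blks g :: 'a ^ 'm::enum) $ (Enum.enum ! j) = g j"
  using blk_of_blks[OF assms, of g] by (simp add: blk_def)

text \<open>\<open>of_blks\<close> locates positions by a definite description, so continuity is
  checked per coordinate, with each index written as an entry of the enumeration.\<close>

lemma continuous_on_of_blks [continuous_intros]:
  assumes "\<And>j. j < CARD('m::enum) \<Longrightarrow> continuous_on S (\<lambda>x. g x j)"
  shows "continuous_on S (\<lambda>x. of_blks (g x) :: ('b::topological_space) ^ 'm::enum)"
proof -
  have "continuous_on S (\<lambda>x. (of_blks (g x) :: 'b ^ 'm::enum) $ i)" for i
  proof -
    have "i \<in> set (Enum.enum :: 'm list)"
      by (simp add: enum_UNIV)
    then obtain j where "j < CARD('m)" "i = Enum.enum ! j"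
      by (auto simp: in_set_conv_nth card_UNIV_length_enum)
    then show ?thesis
      using assms by (simp add: of_blks_nth_enum)
  qed
  then have "continuous_on S (\<lambda>x. \<chi> i. (of_blks (g x) :: 'b ^ 'm::enum) $ i)"
    by (rule continuous_on_vec_lambda)
  then show ?thesis
    by simp
qed

lemma blk_minus [simp]: "blk (x - y) j = blk x j - blk y j"
  by (simp add: blk_def)

lemma blk_scaleR [simp]: "blk (r *\<^sub>R x) j = r *\<^sub>R blk x j"
  by (simp add: blk_def)

lemma blk_zero [simp]: "blk 0 j = 0"
  by (simp add: blk_def)

lemma of_blks_zero [simp]: "(of_blks (\<lambda>j. 0) :: ('a::zero) ^ 'm::enum) = 0"
  by (rule blk_eqI) (simp add: blk_of_blks)

lemma inf_eq_0_vec_iff: "inf a b = 0 \<longleftrightarrow> (\<forall>i. min (a $ i) (b $ i) = 0)" for a b :: "real ^ 'n"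
  by (simp add: vec_eq_iff inf_vec_def inf_min)

lemma inf_scaleR_vec:
  fixes a b :: "real ^ 'n"
  assumes "r \<ge> 0"
  shows "inf (r *\<^sub>R a) (r *\<^sub>R b) = r *\<^sub>R inf a b"
  using assms by (simp add: vec_eq_iff inf_vec_def inf_min min_mult_distrib_left)

text \<open>The value at which the fibre of \<open>EHLCP_map\<close> is the solution set.\<close>

abbreviation rhs_blks :: "real ^ 'n \<Rightarrow> real ^ 'n ^ 'm::enum" where
  "rhs_blks q \<equiv> of_blks (\<lambda>j. if j = 0 then q else 0)"

lemma EHLCP_SOL_iff:
  fixes x :: "real ^ 'n ^ 'm::enum"
  assumes "k \<ge> 1" "CARD('m) = k + 1"
  shows "x \<in> EHLCP_SOL k C d q \<longleftrightarrow> EHLCP_map k C d x = rhs_blks q"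
proof -
  let ?F = "EHLCP_map k C d x"
  have "?F = rhs_blks q \<longleftrightarrow> (\<forall>j<CARD('m). blk ?F j = (if j = 0 then q else 0))"
    using blk_eqI[of ?F "rhs_blks q"] by (auto simp: blk_of_blks)
  also have "\<dots> \<longleftrightarrow> blk ?F 0 = q \<and> blk ?F 1 = 0 \<and> (\<forall>j\<in>{1..k - 1}. blk ?F (j + 1) = 0)"
  proof -
    \<comment> \<open>Blocks 2 to \<open>k\<close> are shifted by one to match the indexing in
      \<open>EHLCP_SOL\<close>; block 1 exists because \<open>k\<close> is at least 1.\<close>
    have "(\<forall>j<k + 1. P j) \<longleftrightarrow> P 0 \<and> P 1 \<and> (\<forall>j\<in>{1..k - 1}. P (j + 1))" for P
    proof
      assume R: "P 0 \<and> P 1 \<and> (\<forall>j\<in>{1..k - 1}. P (j + 1))"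
      show "\<forall>j<k + 1. P j"
      proof (intro allI impI)
        fix j
        assume "j < k + 1"
        then consider "j = 0" | "j = 1" | i where "i \<in> {1..k - 1}" "j = i + 1"
          by (cases j) fastforce+
        then show "P j"
          using R by cases blast+
      qed
    qed (use assms(1) in auto)
    then show ?thesis
      unfolding assms(2) by simp
  qed
  also have "\<dots> \<longleftrightarrow> x \<in> EHLCP_SOL k C d q"
  proof -
    have "blk ?F 0 = C 0 *v blk x 0 - (\<Sum>i = 1..k. C i *v blk x i)" "blk ?F 1 = inf (blk x 0) (blk x 1)"
      using assms by (simp_all add: EHLCP_map_def blk_of_blks)
    moreover have "blk ?F (j + 1) = inf (d j - blk x j) (blk x (j + 1))" if "j \<in> {1..k - 1}" for j
    proof -
      have "j + 1 < CARD('m)" "j \<noteq> 0"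
        using assms that by auto
      then show ?thesis
        by (simp add: EHLCP_map_def blk_of_blks)
    qed
    ultimately show ?thesis
      by (simp add: EHLCP_SOL_def diff_eq_eq add.commute)
  qed
  finally show ?thesis ..
qed

section \<open>Norm bound for solutions, uniform in \<open>d\<close>\<close>

lemma EHLCP_SOL_complementary:
  fixes x :: "real ^ 'n ^ 'm::enum"
  assumes d: "pos_tuple k d" and x: "x \<in> EHLCP_SOL k C d q" and j: "j \<in> {1..k}"
  shows "inf (blk x 0) (blk x j) = 0"
proof -
  have "1 \<le> j" "j \<le> k"
    using j by auto
  then show ?thesis
  proof (induction j rule: dec_induct)
    case base
    show ?case
      using x by (simp add: EHLCP_SOL_def)
  next
    case (step j)
    then have "j \<in> {1..k - 1}"
      by auto
    then have "inf (d j - blk x j) (blk x (Suc j)) = 0" "\<And>i. 0 < d j $ i"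
      using x d by (auto simp: EHLCP_SOL_def pos_tuple_def)
    moreover have "inf (blk x 0) (blk x j) = 0"
      using step by simp
    \<comment> \<open>Scalar form of the induction step: \<open>a > 0\<close> gives
      \<open>a' = 0\<close>, so \<open>e - a' > 0\<close> and \<open>a'' = 0\<close>; if
      \<open>a = 0\<close>, then \<open>a'' \<ge> 0\<close> suffices.\<close>
    moreover have "min a a'' = 0"
      if "min (e - a') a'' = 0" "0 < e" "min a a' = 0" for a a' a'' e :: real
      using that by (auto simp: min_def split: if_splits)
    ultimately show ?case
      unfolding inf_eq_0_vec_iff vector_minus_component by blast
  qed
qed

text \<open>\<open>c\<close> is fixed before \<open>d\<close> and \<open>q\<close>, so one bound
  controls a whole deformation of the data.\<close>

lemma EHLCP_SOL_norm_bound: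
  fixes C :: "nat \<Rightarrow> real ^ 'n ^ 'n"
  assumes R0: "R0_W TYPE('m::enum) k C"
  obtains c where "c > 0"
    "\<And>d q (x :: real ^ 'n ^ 'm::enum). \<lbrakk>pos_tuple k d; x \<in> EHLCP_SOL k C d q\<rbrakk> \<Longrightarrow> c * norm x \<le> norm q"
proof -
  \<comment> \<open>The residual of the system in \<open>R0_W\<close>. It is positively homogeneous,
    so its minimum on the unit sphere can serve as \<open>c\<close>.\<close>
  define \<phi> where "\<phi> = (\<lambda>x :: real ^ 'n ^ 'm::enum. norm (C 0 *v blk x 0 - (\<Sum>i = 1..k. C i *v blk x i))
    + (\<Sum>j = 1..k. norm (inf (blk x 0) (blk x j))))"
  have \<phi>_scale: "\<phi> (r *\<^sub>R x) = r * \<phi> x" if "r \<ge> 0" for r x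
    using that
    by (simp add: \<phi>_def inf_scaleR_vec linear_scale[OF matrix_vector_mul_linear] distrib_left
        sum_distrib_left flip: scaleR_sum_right scaleR_diff_right)
  have "continuous_on (sphere 0 1) \<phi>"
    unfolding \<phi>_def by (intro continuous_intros)
  moreover have "compact (sphere 0 1 :: (real ^ 'n ^ 'm::enum) set)" "sphere 0 1 \<noteq> ({} :: (real ^ 'n ^ 'm::enum) set)"
    by auto
  ultimately obtain u where u: "u \<in> sphere 0 1" "\<And>x. x \<in> sphere 0 1 \<Longrightarrow> \<phi> u \<le> \<phi> x"
    using continuous_attains_inf by metis
  have \<phi>_nonneg: "\<phi> x \<ge> 0" for x
    unfolding \<phi>_def by (intro add_nonneg_nonneg sum_nonneg) auto
  have "\<phi> u \<noteq> 0"
  proof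
    assume "\<phi> u = 0"
    then have "norm (C 0 *v blk u 0 - (\<Sum>i = 1..k. C i *v blk u i)) = 0
        \<and> (\<Sum>j = 1..k. norm (inf (blk u 0) (blk u j))) = 0"
      unfolding \<phi>_def by (subst (asm) add_nonneg_eq_0_iff) (auto intro: sum_nonneg)
    then have "u = 0"
      using R0 unfolding R0_W_def by (simp add: sum_nonneg_eq_0_iff)
    then show False
      using u by simp
  qed
  then have pos: "\<phi> u > 0"
    using \<phi>_nonneg[of u] by simp
  have bound: "\<phi> u * norm x \<le> \<phi> x" for x
  proof (cases "x = 0")
    case False
    have "\<phi> u \<le> \<phi> (inverse (norm x) *\<^sub>R x)"
      using False by (intro u) simp
    then show ?thesis
      using False by (simp add: \<phi>_scale field_simps)
  qed (simp add: \<phi>_nonneg)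
  show thesis
  proof (rule that[OF pos])
    fix d q and x :: "real ^ 'n ^ 'm::enum"
    assume "pos_tuple k d" and x: "x \<in> EHLCP_SOL k C d q"
    \<comment> \<open>Complementarity kills every \<open>inf\<close> term, and the linear part
      equals \<open>q\<close>.\<close>
    then have "\<phi> x = norm q"
      by (simp add: \<phi>_def EHLCP_SOL_complementary) (simp add: EHLCP_SOL_def)
    then show "\<phi> u * norm x \<le> norm q"
      using bound[of x] by simp
  qed
qed

text \<open>\<open>d\<close> may vary with \<open>s\<close>, as it does along the homotopy
  below.\<close>

lemma continuous_on_EHLCP_map [continuous_intros]:
  fixes f :: "'a::topological_space \<Rightarrow> real ^ 'n ^ 'm::enum"
  assumes "continuous_on S f" "\<And>j. continuous_on S (\<lambda>s. d s j)"
  shows "continuous_on S (\<lambda>s. EHLCP_map k C (d s) (f s))"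
  unfolding EHLCP_map_def
proof (intro continuous_on_of_blks)
  fix j
  show "continuous_on S (\<lambda>s. if j = 0 then C 0 *v blk (f s) 0 - (\<Sum>i = 1..k. C i *v blk (f s) i)
     else if j = 1 then inf (blk (f s) 0) (blk (f s) 1)
     else inf (d s (j - 1) - blk (f s) (j - 1)) (blk (f s) j))"
    using assms by (cases "j = 0"; cases "j = 1") (auto intro!: continuous_intros)
qed

lemma compact_EHLCP_SOL:
  fixes C :: "nat \<Rightarrow> real ^ 'n ^ 'n"
  assumes "k \<ge> 1" "CARD('m::enum) = k + 1" "R0_W TYPE('m) k C" "pos_tuple k d"
  shows "compact (EHLCP_SOL k C d q :: (real ^ 'n ^ 'm::enum) set)"
  unfolding compact_eq_bounded_closed
proof
  obtain c where "c > 0"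
    and c: "\<And>d q (x :: real ^ 'n ^ 'm::enum). \<lbrakk>pos_tuple k d; x \<in> EHLCP_SOL k C d q\<rbrakk> \<Longrightarrow> c * norm x \<le> norm q"
    using EHLCP_SOL_norm_bound[OF assms(3)] by metis
  have "norm x \<le> norm q / c" if "x \<in> EHLCP_SOL k C d q" for x :: "real ^ 'n ^ 'm::enum"
    using c[OF assms(4) that] \<open>c > 0\<close> by (simp add: field_simps)
  then show "bounded (EHLCP_SOL k C d q :: (real ^ 'n ^ 'm::enum) set)"
    unfolding bounded_iff by blast
  have "EHLCP_SOL k C d q = {x :: real ^ 'n ^ 'm::enum. EHLCP_map k C d x = rhs_blks q}"
    using EHLCP_SOL_iff[OF assms(1,2)] by blast
  then show "closed (EHLCP_SOL k C d q :: (real ^ 'n ^ 'm::enum) set)"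
    by (simp add: closed_Collect_eq continuous_intros)
qed

theorem theorem3p3:
  fixes k :: nat
    and C :: "nat \<Rightarrow> real ^ 'n ^ 'n"
    and d_hat :: "nat \<Rightarrow> real ^ 'n"
    and \<Omega> :: "(real ^ 'n ^ 'm::enum) set"
  assumes "k \<ge> 1" and "CARD('m) = k + 1"
    and "R0_W TYPE('m) k C"
    and "pos_tuple k d_hat"
    and "open \<Omega>" and "bounded \<Omega>" and "0 \<in> \<Omega>"
    and "brouwer_degree (EHLCP_map k C d_hat) \<Omega> 0 \<noteq> 0"
  shows "\<forall>(q :: real ^ 'n) (d :: nat \<Rightarrow> real ^ 'n). pos_tuple k d \<longrightarrow>
    (EHLCP_SOL k C d q :: (real ^ 'n ^ 'm::enum) set) \<noteq> {} \<and>
    compact (EHLCP_SOL k C d q :: (real ^ 'n ^ 'm::enum) set)"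
proof (intro allI impI conjI)
  fix q :: "real ^ 'n" and d :: "nat \<Rightarrow> real ^ 'n"
  assume d: "pos_tuple k d"
  show "compact (EHLCP_SOL k C d q :: (real ^ 'n ^ 'm::enum) set)"
    using assms(1-3) d by (rule compact_EHLCP_SOL)
  show "(EHLCP_SOL k C d q :: (real ^ 'n ^ 'm::enum) set) \<noteq> {}"
  proof
    assume empty: "(EHLCP_SOL k C d q :: (real ^ 'n ^ 'm::enum) set) = {}"
    obtain c where "c > 0"
      and c: "\<And>d q (x :: real ^ 'n ^ 'm::enum). \<lbrakk>pos_tuple k d; x \<in> EHLCP_SOL k C d q\<rbrakk> \<Longrightarrow> c * norm x \<le> norm q"
      using EHLCP_SOL_norm_bound[OF assms(3)] by metis
    define D where "D = (\<lambda>t j. (1 - t) *\<^sub>R d_hat j + t *\<^sub>R d j)"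
    \<comment> \<open>Moves \<open>d_hat\<close> to \<open>d\<close> and 0 to \<open>q\<close>
      simultaneously; zeros at time \<open>t\<close> are solutions for the interpolated
      data.\<close>
    define G where "G = (\<lambda>t (x :: real ^ 'n ^ 'm::enum). EHLCP_map k C (D t) x - rhs_blks (t *\<^sub>R q))"
    have G_zero: "G t x = 0 \<longleftrightarrow> x \<in> EHLCP_SOL k C (D t) (t *\<^sub>R q)" for t x
      using EHLCP_SOL_iff[OF assms(1,2), of x] by (simp add: G_def)
    have D_pos: "pos_tuple k (D t)" if "t \<in> {0..1}" for t
      unfolding pos_tuple_def
    proof (intro ballI allI)
      fix j i
      assume "j \<in> {1..k - 1}"
      then have "d_hat j $ i > 0" "d j $ i > 0"
        using assms(4) d by (auto simp: pos_tuple_def)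
      then show "D t j $ i > 0"
        \<comment> \<open>At \<open>t = 0\<close> only \<open>d_hat\<close> remains; for
          \<open>t > 0\<close> the term with \<open>d\<close> is strictly positive and the other
          nonnegative.\<close>
        using that by (cases "t = 0") (auto simp: D_def intro: add_nonneg_pos)
    qed
    have D_01: "D 0 = d_hat" "D 1 = d"
      by (simp_all add: D_def fun_eq_iff)
    have "brouwer_degree (EHLCP_map k C d_hat) \<Omega> 0 = 0"
    \<comment> \<open>The radius works for all times, since
      \<open>norm (t *\<^sub>R q) \<le> norm q\<close> on the unit interval.\<close>
    proof (rule brouwer_degree_eq_0_of_homotopy[OF assms(5-7), where G = G and R = "norm q / c"])
      show "continuous_on UNIV (EHLCP_map k C d_hat :: real ^ 'n ^ 'm::enum \<Rightarrow> _)"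
        by (intro continuous_intros)
      \<comment> \<open>The norm bound at \<open>q = 0\<close> excludes nonzero solutions;
        positivity of \<open>d_hat\<close> makes the origin one.\<close>
      show "EHLCP_map k C d_hat x = 0 \<longleftrightarrow> x = 0" for x :: "real ^ 'n ^ 'm::enum"
      proof
        assume "EHLCP_map k C d_hat x = 0"
        then have "x \<in> EHLCP_SOL k C d_hat 0"
          using EHLCP_SOL_iff[OF assms(1,2), of x C d_hat 0] by simp
        then have "c * norm x \<le> 0"
          using c[OF assms(4), of x 0] by simp
        then show "x = 0"
          using \<open>c > 0\<close> by (simp add: mult_le_0_iff)
      next
        assume "x = 0"
        then have "x \<in> EHLCP_SOL k C d_hat 0"
          using assms(4) by (simp add: EHLCP_SOL_def pos_tuple_def inf_eq_0_vec_iff min_absorb2 less_imp_le)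
        then show "EHLCP_map k C d_hat x = 0"
          using EHLCP_SOL_iff[OF assms(1,2), of x C d_hat 0] by simp
      qed
      show "continuous_on ({0..1} \<times> UNIV) (\<lambda>(t, x). G t x)"
        unfolding G_def D_def case_prod_unfold
      proof (intro continuous_intros)
        show "continuous_on ({0..1} \<times> UNIV)
            (\<lambda>p :: real \<times> (real ^ 'n ^ 'm::enum). if j = 0 then fst p *\<^sub>R q else 0)" for j :: nat
          by (cases "j = 0") (auto intro!: continuous_intros)
      qed
      show "G 0 x = EHLCP_map k C d_hat x" for x
        by (simp add: G_def D_01 cong: if_cong)
      show "G 1 x \<noteq> 0" for x
        using G_zero[of 1 x] empty by (simp add: D_01)
      show "norm q / c \<ge> 0"
        using \<open>c > 0\<close> by simp
      show "norm x \<le> norm q / c" if t: "t \<in> {0..1}" and "G t x = 0" for t x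
      proof -
        have "c * norm x \<le> norm (t *\<^sub>R q)"
          using that(2) G_zero c[OF D_pos[OF t]] by blast
        also have "\<dots> \<le> norm q"
          using t by (simp add: mult_left_le_one_le)
        finally show ?thesis
          using \<open>c > 0\<close> by (simp add: field_simps)
      qed
    qed
    then show False
      using assms(8) by simp
  qed
qed

end
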